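(* Let $n\ge 2$ and let $T_1,\ldots,T_n$ be any non-trivial trees (not necessarily distinct). Then the zombie number of their Cartesian product is $$z\left(T_1\,\square\,T_2\,\square\cdots\square\,T_n\right)=\left\lceil \frac{2n}{3}\right\rceil .$$
   Context: All graphs are finite and simple. A tree is non-trivial if it has at least two vertices. Cartesian product: $T_1\,\square\cdots\square\,T_n$ has vertex set $V(T_1)\times\cdots\times V(T_n)$; two vertices $(x_1,\ldots,x_n)$ and $(y_1,\ldots,y_n)$ are adjacent if and only if there is an index $i$ with $x_iy_i\in E(T_i)$ and $x_j=y_j$ for all $j\ne i$. Game of Zombies and Survivor on a connected graph $G$: a set of zombies plays against a single survivor, with full information. In round zero, each zombie first chooses a vertex to occupy (several zombies may occupy the same vertex), and then the survivor chooses a vertex. In each subsequent round the zombies move first, and then the survivor moves. On the zombies' turn, every zombie must move to an adjacent vertex that is strictly closer (in graph distance) to the survivor's current vertex, i.e. it must move along a geodesic joining it to the survivor; if several such vertices exist, the zombie may choose which one. On the survivor's turn, the survivor either moves to an adjacent vertex or stays at the current vertex (passes). The zombies win if, after finitely many rounds, some zombie occupies the same vertex as the survivor (the survivor is captured and the game ends); otherwise the survivor wins. The zombie number $z(G)$ is the minimum number of zombies for which the zombies have a strategy (choice of initial positions and of moves) that guarantees capture of the survivor on $G$, whatever the survivor does. *)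

theory Defs
  imports "Graph_Theory.Graph_Theory"
begin

text \<open>
  A finite simple graph is a loop-free symmetric digraph without parallel arcs (\<open>pair_graph\<close>),
  every undirected edge being represented by its two orientations.
\<close>

text \<open>
  The predicate \<open>forest\<close> of the library is meant for oriented graphs: in a symmetric digraph it
  rejects every edge, since an edge traversed back and forth is a \<open>cycle\<close> of length 2 there.
  Hence cycles are required to have length at least 3 here.
\<close>

definition tree_graph :: "'a pair_pre_digraph \<Rightarrow> bool" where
  "tree_graph G \<longleftrightarrow>
     pair_graph G \<and>
     Digraph_Component.connected (with_proj G) \<and>
     \<not> (\<exists>p. pre_digraph.cycle (with_proj G) p \<and> 3 \<le> length p)"

definition nontrivial_tree :: "'a pair_pre_digraph \<Rightarrow> bool" where
  "nontrivial_tree G \<longleftrightarrow> tree_graph G \<and> 2 \<le> card (pverts G)"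

definition cartesian_product ::
    "'i set \<Rightarrow> ('i \<Rightarrow> 'a pair_pre_digraph) \<Rightarrow> ('i \<Rightarrow> 'a) pair_pre_digraph" where
  "cartesian_product I T =
     \<lparr> pverts = (\<Pi>\<^sub>E i\<in>I. pverts (T i)),
       parcs = {(x, y). x \<in> (\<Pi>\<^sub>E i\<in>I. pverts (T i)) \<and> y \<in> (\<Pi>\<^sub>E i\<in>I. pverts (T i)) \<and>
                 (\<exists>i\<in>I. (x i, y i) \<in> parcs (T i) \<and> (\<forall>j\<in>I. j \<noteq> i \<longrightarrow> x j = y j))} \<rparr>"

abbreviation gdist :: "'v pair_pre_digraph \<Rightarrow> 'v \<Rightarrow> 'v \<Rightarrow> ereal" where
  "gdist G u v \<equiv> wf_digraph.\<mu> (with_proj G) (\<lambda>_. 1) u v"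

text \<open>
  Zombie positions are lists, one entry per zombie.  \<open>Z t\<close> is the position of the zombies after
  their turn in round \<open>t\<close>, and \<open>s t\<close> that of the survivor after the survivor's turn in round \<open>t\<close>;
  so in round \<open>Suc t\<close> the zombies move from \<open>Z t\<close> to \<open>Z (Suc t)\<close> facing the survivor at \<open>s t\<close>.
\<close>

definition zombies_move :: "'v pair_pre_digraph \<Rightarrow> 'v \<Rightarrow> 'v list \<Rightarrow> 'v list \<Rightarrow> bool" where
  "zombies_move G v = list_all2 (\<lambda>x y. (x, y) \<in> parcs G \<and> gdist G y v < gdist G x v)"

definition survivor_play :: "'v pair_pre_digraph \<Rightarrow> (nat \<Rightarrow> 'v) \<Rightarrow> bool" where
  "survivor_play G s \<longleftrightarrow>
     s 0 \<in> pverts G \<and> (\<forall>t. s (Suc t) = s t \<or> (s t, s (Suc t)) \<in> parcs G)"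

text \<open>
  Capture at some moment up to the end of round \<open>t\<close>, which may happen on the survivor's turn of a
  round \<open>r \<le> t\<close> or on the zombies' turn of round \<open>Suc r \<le> t\<close>.
\<close>

definition captured_by :: "(nat \<Rightarrow> 'v list) \<Rightarrow> (nat \<Rightarrow> 'v) \<Rightarrow> nat \<Rightarrow> bool" where
  "captured_by Z s t \<longleftrightarrow>
     (\<exists>r\<le>t. s r \<in> set (Z r)) \<or> (\<exists>r<t. s r \<in> set (Z (Suc r)))"

text \<open>
  A zombie strategy \<open>\<sigma>\<close> maps the list of the survivor's positions so far to the zombies' next
  positions; \<open>\<sigma> []\<close> is the initial placement.  The earlier zombie positions need not be
  arguments, being determined by \<open>\<sigma>\<close> and the survivor's positions.
\<close>

definition zombies_at :: "('v list \<Rightarrow> 'v list) \<Rightarrow> (nat \<Rightarrow> 'v) \<Rightarrow> nat \<Rightarrow> 'v list" where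
  "zombies_at \<sigma> s t = \<sigma> (map s [0..<t])"

text \<open>
  The strategy has to obey the rules only until the survivor is captured, when the game ends.
\<close>

definition winning_zombie_strategy ::
    "'v pair_pre_digraph \<Rightarrow> nat \<Rightarrow> ('v list \<Rightarrow> 'v list) \<Rightarrow> bool" where
  "winning_zombie_strategy G k \<sigma> \<longleftrightarrow>
     length (\<sigma> []) = k \<and> set (\<sigma> []) \<subseteq> pverts G \<and>
     (\<forall>s. survivor_play G s \<longrightarrow>
        (\<forall>t. \<not> captured_by (zombies_at \<sigma> s) s t \<longrightarrow>
              zombies_move G (s t) (zombies_at \<sigma> s t) (zombies_at \<sigma> s (Suc t))) \<and>
        (\<exists>t. captured_by (zombies_at \<sigma> s) s t))"

definition zombie_number :: "'v pair_pre_digraph \<Rightarrow> nat" where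
  "zombie_number G = (LEAST k. \<exists>\<sigma>. winning_zombie_strategy G k \<sigma>)"

text \<open>The minimum is attained, as one zombie on every vertex wins at once.\<close>

lemma zombie_number_attained:
  assumes "finite (pverts G)"
  shows "\<exists>\<sigma>. winning_zombie_strategy G (zombie_number G) \<sigma>"
proof -
  obtain xs where xs: "set xs = pverts G"
    using finite_list[OF assms] by blast
  have "captured_by (zombies_at (\<lambda>_. xs) s) s t" if "survivor_play G s" for s t
  proof -
    have "s 0 \<in> set (zombies_at (\<lambda>_. xs) s 0)"
      using that xs by (simp add: survivor_play_def zombies_at_def)
    then show ?thesis
      unfolding captured_by_def by blast
  qed
  then have "winning_zombie_strategy G (length xs) (\<lambda>_. xs)"
    using xs unfolding winning_zombie_strategy_def by blast
  then have "\<exists>k \<sigma>. winning_zombie_strategy G k \<sigma>"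
    by blast
  then show ?thesis
    unfolding zombie_number_def by (rule LeastI_ex)
qed

end

theory Submission
  imports Defs
begin

text \<open>
  In a product of trees the distance is the sum of the distances in the coordinates, and every move
  changes the distance between a zombie and the survivor by exactly one.  So a zombie's turn is the
  choice of a coordinate in which it differs from the survivor, and after a round in which the
  survivor moves all distances have the parities that they had before, while after a pass all have
  changed.

  After the zombies' turn, a zombie at distance 1 keeps the survivor from passing and from moving
  toward it in the only coordinate in which they differ; a zombie at distance 2 makes a move in at
  most two coordinates fatal; zombies farther away are no threat.

  Fewer than \<open>2 * n / 3\<close> zombies lose.  The survivor starts such that, after the zombies' turn, at
  least half of the \<open>k\<close> distances are odd, and from then on never passes, which preserves this.  The
  zombies block at most one coordinate each if their distance is odd and two if it is even, hence at
  most \<open>3 * k / 2 < n\<close> altogether, and the survivor always has a safe move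
  (\<open>survivor_has_safe_move\<close>).

  If \<open>k\<close> is at least \<open>2 * n / 3\<close>, the zombies win.  They start on the two ends of an edge, in
  turn, so that at any time at least \<open>k div 2\<close> distances are even.  Until a capture the distances are
  positive, so their sum is at least \<open>k + k div 2\<close>, which is at least \<open>n\<close>.  This sum decreases
  whenever the survivor passes or approaches some zombie, so eventually the survivor moves away from
  all zombies in every round.  Suppose this happens in coordinate \<open>l\<close>.  If some zombie differs from the
  survivor in \<open>l\<close>, all zombies follow in \<open>l\<close>, and the survivor is driven toward the leaves of the \<open>l\<close>-th
  tree (\<open>shadow_shrinks\<close>).  If none does, then by counting some other coordinate is at total distance
  at least 2, and one zombie can afford to move there instead of following in \<open>l\<close>, so that more
  coordinates than before have a zombie differing from the survivor.  Both can be repeated only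
  finitely often (\<open>progress_round\<close>).
\<close>

section \<open>Distance in a tree\<close>

definition tree_dist :: "'v pair_pre_digraph \<Rightarrow> 'v \<Rightarrow> 'v \<Rightarrow> nat" where
  "tree_dist G u v = (LEAST m. (u, v) \<in> parcs G ^^ m)"

lemma tree_arcs:
  assumes "tree_graph G" "(u, v) \<in> parcs G"
  shows "u \<in> pverts G" "v \<in> pverts G" "u \<noteq> v" "(v, u) \<in> parcs G"
proof -
  interpret pair_graph G using assms(1) by (simp add: tree_graph_def)
  show "u \<in> pverts G" "v \<in> pverts G" "u \<noteq> v" "(v, u) \<in> parcs G"
    using assms(2) by (auto dest: in_arcsD1 in_arcsD2 arcs_symmetric no_loops')
qed

lemma finite_tree_verts: "tree_graph G \<Longrightarrow> finite (pverts G)"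
  by (auto simp: tree_graph_def pair_graph_def pair_digraph_def pair_fin_digraph_def
      pair_fin_digraph_axioms_def)

lemma tree_dist_walk:
  assumes "tree_graph G" "u \<in> pverts G" "v \<in> pverts G"
  shows "(u, v) \<in> parcs G ^^ tree_dist G u v"
proof -
  interpret pair_graph G using assms(1) by (simp add: tree_graph_def)
  have "Digraph_Component.connected (with_proj G)"
    using assms(1) by (simp add: tree_graph_def)
  then have "u \<rightarrow>\<^sup>*\<^bsub>with_proj G\<^esub> v"
    using symmetric_connected_imp_strongly_connected[OF pair_sym_arcs] assms(2,3)
    by (simp add: strongly_connected_def)
  then have "(u, v) \<in> (parcs G)\<^sup>*"
    by (auto simp: reachable_def dest: rtrancl_on_rtranclI)
  then show ?thesis
    unfolding tree_dist_def by (auto simp: rtrancl_power intro: LeastI)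
qed

lemma tree_dist_le: "(u, v) \<in> parcs G ^^ m \<Longrightarrow> tree_dist G u v \<le> m"
  unfolding tree_dist_def by (rule Least_le)

lemma tree_dist_self [simp]: "tree_dist G u u = 0"
  using tree_dist_le[where m = 0] by fastforce

lemma tree_dist_eq_0_iff:
  assumes "tree_graph G" "u \<in> pverts G" "v \<in> pverts G"
  shows "tree_dist G u v = 0 \<longleftrightarrow> u = v"
  using tree_dist_walk[OF assms] by (cases "tree_dist G u v = 0") auto

lemma tree_dist_triangle:
  assumes "tree_graph G" "u \<in> pverts G" "v \<in> pverts G" "w \<in> pverts G"
  shows "tree_dist G u w \<le> tree_dist G u v + tree_dist G v w"
  using tree_dist_walk[OF assms(1-3)] tree_dist_walk[OF assms(1,3,4)]
  by (intro tree_dist_le) (auto simp: relpow_add)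

lemma tree_dist_arc:
  assumes "tree_graph G" "(u, v) \<in> parcs G"
  shows "tree_dist G u v = 1"
proof -
  have "tree_dist G u v \<le> 1" using assms(2) by (intro tree_dist_le) simp
  moreover have "tree_dist G u v \<noteq> 0"
    using tree_dist_eq_0_iff assms tree_arcs[OF assms] by metis
  ultimately show ?thesis by linarith
qed

lemma tree_dist_commute:
  assumes "tree_graph G" "u \<in> pverts G" "v \<in> pverts G"
  shows "tree_dist G u v = tree_dist G v u"
proof -
  have sym: "sym (parcs G)"
    using tree_arcs(4)[OF assms(1)] by (auto intro: symI)
  have "sym (parcs G ^^ m)" for m
  proof (induction m)
    case (Suc m)
    then show ?case
      by (metis sym converse_relcomp relpow.simps(2) relpow_commute sym_conv_converse_eq)
  qed (auto simp: sym_def)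
  then show ?thesis
    by (intro antisym tree_dist_le) (metis symD tree_dist_walk assms)+
qed

lemma tree_dist_descent:
  assumes "tree_graph G" "u \<in> pverts G" "v \<in> pverts G" "u \<noteq> v"
  obtains u' where "(u, u') \<in> parcs G" "tree_dist G u v = Suc (tree_dist G u' v)"
proof -
  from tree_dist_eq_0_iff[OF assms(1-3)] assms(4) obtain m where m: "tree_dist G u v = Suc m"
    by (cases "tree_dist G u v") auto
  with tree_dist_walk[OF assms(1-3)] obtain u' where u': "(u, u') \<in> parcs G" "(u', v) \<in> parcs G ^^ m"
    by (metis relpow_Suc_E2)
  have "tree_dist G u v \<le> 1 + tree_dist G u' v"
    using tree_dist_triangle tree_dist_arc tree_arcs(2) assms u'(1) by metis
  moreover have "tree_dist G u' v \<le> m" using u'(2) by (rule tree_dist_le)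
  ultimately show ?thesis using u'(1) m that by simp
qed

text \<open>
  Only here does acyclicity enter: a path from one neighbour of \<open>a\<close> to another that avoids \<open>a\<close> would
  close up, through \<open>a\<close>, to a cycle of length at least 3.  Applied to shortest paths, this yields what
  distinguishes the distances in a tree from those in other connected graphs.
\<close>

lemma no_detour_around_vertex:
  assumes G: "tree_graph G"
    and arcs: "(a, x) \<in> parcs G" "(a, y) \<in> parcs G" "x \<noteq> y"
    and walk: "pre_digraph.awalk (with_proj G) x p y" "a \<notin> set (pawalk_verts x p)"
  shows False
proof -
  interpret pair_graph G using G by (simp add: tree_graph_def)
  define q where "q = awalk_to_apath p"
  have q: "apath x q y" using apath_awalk_to_apath walk(1) by (simp add: q_def)
  have "set (pawalk_verts x q) \<subseteq> set (pawalk_verts x p)"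
    using awalk_to_apath_subset[OF walk(1)] set_awalk_verts[OF walk(1)] q set_awalk_verts[of x q y]
    by (auto simp: q_def apath_def)
  with walk(2) have aq: "a \<notin> set (pawalk_verts x q)" by blast
  have qw: "awalk x q y" "distinct (pawalk_verts x q)" using q by (auto simp: apath_def)
  have ya: "awalk y [(y, a)] a"
    using tree_arcs[OF G arcs(2)] by (auto simp: awalk_simps)
  have "awalk x (q @ [(y, a)]) a" using qw(1) ya by (rule awalk_appendI)
  moreover have "pawalk_verts x (q @ [(y, a)]) = pawalk_verts x q @ [a]"
    using awalk_verts_append[OF \<open>awalk x (q @ [(y, a)]) a\<close>] qw(1) by simp
  ultimately have "cycle ((a, x) # q @ [(y, a)])"
    unfolding cycle_def using aq qw(2) arcs(1) tree_arcs(1)[OF G arcs(1)]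
    by (intro exI[of _ a]) (auto simp: awalk_Cons_iff)
  moreover have "q \<noteq> []" using qw(1) arcs(3) by (auto simp: awalk_Nil_iff)
  then have "3 \<le> length ((a, x) # q @ [(y, a)])" by (cases q) auto
  ultimately show False using G unfolding tree_graph_def by blast
qed

text \<open>
  Along a shortest path to \<open>w\<close> the distance to \<open>w\<close> drops strictly, so every vertex after the first is
  closer to \<open>w\<close> than \<open>a\<close> is.
\<close>

lemma geodesic_avoids_farther_vertex:
  assumes G: "tree_graph G" and "x \<in> pverts G" "w \<in> pverts G"
    and "tree_dist G x w \<le> tree_dist G a w" "x \<noteq> a"
  shows "\<exists>p. pre_digraph.awalk (with_proj G) x p w \<and> a \<notin> set (pawalk_verts x p)"
  using assms(2-)
proof (induction "tree_dist G x w" arbitrary: x)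
  interpret pair_graph G using G by (simp add: tree_graph_def)
  {
    case 0
    then have "x = w" using tree_dist_eq_0_iff[OF G] by simp
    then show ?case using 0 by (intro exI[of _ "[]"]) (simp add: awalk_Nil_iff)
  next
    case (Suc m)
    have "x \<noteq> w" using Suc.hyps(2) by auto
    with Suc.prems obtain y where y: "(x, y) \<in> parcs G" "tree_dist G x w = Suc (tree_dist G y w)"
      using tree_dist_descent[OF G] by metis
    have "m = tree_dist G y w" "y \<in> pverts G" "tree_dist G y w \<le> tree_dist G a w" "y \<noteq> a"
      using y Suc.hyps(2) Suc.prems tree_arcs[OF G y(1)] by auto
    from Suc.hyps(1)[OF this(1,2) Suc.prems(2) this(3,4)] obtain p
      where p: "awalk y p w" "a \<notin> set (pawalk_verts y p)" by auto
    then have "awalk x ((x, y) # p) w" "a \<notin> set (pawalk_verts x ((x, y) # p))"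
      using y(1) Suc.prems by (auto simp: awalk_Cons_iff)
    then show ?case by blast
  }
qed

text \<open>
  Shortest paths from \<open>x\<close> and from \<open>y\<close> to \<open>w\<close> both avoid \<open>a\<close>, so together they would join two distinct
  neighbours of \<open>a\<close> around it.  The comparison is deliberately not strict: it gives both that the step
  toward \<open>w\<close> is unique and, in the next lemma, that no neighbour is equally far from \<open>w\<close>.
\<close>

lemma no_detour_between_closer_neighbours:
  assumes G: "tree_graph G" and w: "w \<in> pverts G"
    and arcs: "(a, x) \<in> parcs G" "(a, y) \<in> parcs G"
    and closer: "tree_dist G x w \<le> tree_dist G a w" "tree_dist G y w \<le> tree_dist G a w"
  shows "x = y"
proof (rule ccontr)
  interpret pair_graph G using G by (simp add: tree_graph_def)
  assume "x \<noteq> y"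
  obtain p where p: "awalk x p w" "a \<notin> set (pawalk_verts x p)"
    using geodesic_avoids_farther_vertex[OF G _ w closer(1)] tree_arcs[OF G arcs(1)] by auto
  obtain q where q: "awalk y q w" "a \<notin> set (pawalk_verts y q)"
    using geodesic_avoids_farther_vertex[OF G _ w closer(2)] tree_arcs[OF G arcs(2)] by auto
  have rq: "awalk w (rev_path q) y" "a \<notin> set (pawalk_verts w (rev_path q))"
    using q awalk_verts_rev_path[OF q(1)] by simp_all
  have "awalk x (p @ rev_path q) y" using p(1) rq(1) by (rule awalk_appendI)
  moreover from this have "a \<notin> set (pawalk_verts x (p @ rev_path q))"
    using p rq set_awalk_verts_append[OF p(1) rq(1)] by simp
  ultimately show False
    using no_detour_around_vertex[OF G arcs \<open>x \<noteq> y\<close>] by blast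
qed

text \<open>
  Trees are bipartite.  If \<open>b\<close> and \<open>b'\<close> were equally far from \<open>w\<close>, then \<open>b'\<close> and the next vertex \<open>c\<close> on
  the way from \<open>b\<close> to \<open>w\<close> would be two neighbours of \<open>b\<close> violating the previous lemma.
\<close>

lemma tree_dist_step:
  assumes G: "tree_graph G" and "w \<in> pverts G" "(b, b') \<in> parcs G"
  shows "tree_dist G b' w = Suc (tree_dist G b w) \<or> tree_dist G b w = Suc (tree_dist G b' w)"
proof -
  note b = tree_arcs[OF G assms(3)]
  have "tree_dist G b w \<le> 1 + tree_dist G b' w" "tree_dist G b' w \<le> 1 + tree_dist G b w"
    using tree_dist_triangle[OF G b(1,2) assms(2)] tree_dist_triangle[OF G b(2,1) assms(2)]
      tree_dist_arc[OF G] assms(3) b(4) by simp_all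
  moreover have "tree_dist G b w \<noteq> tree_dist G b' w"
  proof
    assume eq: "tree_dist G b w = tree_dist G b' w"
    then have "b \<noteq> w"
      using b tree_dist_eq_0_iff[OF G b(2) assms(2)] by auto
    then obtain c where c: "(b, c) \<in> parcs G" "tree_dist G b w = Suc (tree_dist G c w)"
      using tree_dist_descent[OF G b(1) assms(2)] by metis
    have "c = b'"
      using no_detour_between_closer_neighbours[OF G assms(2) c(1) assms(3)] c(2) eq by simp
    then show False using eq c(2) by simp
  qed
  ultimately show ?thesis by linarith
qed


text \<open>
  The part of the tree that lies behind \<open>b\<close> when seen from \<open>a\<close>; for \<open>a = b\<close> this is the whole tree.
\<close>

definition shadow :: "'v pair_pre_digraph \<Rightarrow> 'v \<Rightarrow> 'v \<Rightarrow> 'v set" where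
  "shadow G a b = {w \<in> pverts G. tree_dist G a w = tree_dist G a b + tree_dist G b w}"

lemma shadow_self [simp]: "shadow G a a = pverts G"
  by (simp add: shadow_def)

text \<open>
  Fleeing from a pursuer in a tree cannot go on forever: after the fugitive has stepped from \<open>b\<close> away
  from \<open>a\<close> and the pursuer has followed, less of the tree lies behind the fugitive.  The shadow of
  \<open>b'\<close> is the same from \<open>a'\<close> as from \<open>a\<close>, because a path to \<open>b'\<close> cannot turn back, and as seen from \<open>a\<close>
  it is contained in the shadow of \<open>b\<close> without containing \<open>b\<close>.
\<close>

lemma shadow_shrinks:
  assumes G: "tree_graph G" and verts: "a \<in> pverts G" "b \<in> pverts G" "a \<noteq> b"
    and b': "(b, b') \<in> parcs G" "tree_dist G a b' = Suc (tree_dist G a b)"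
    and a': "(a, a') \<in> parcs G" "tree_dist G a b' = Suc (tree_dist G a' b')"
  shows "shadow G a' b' \<subset> shadow G a b"
proof -
  note arcs = tree_arcs[OF G b'(1)] tree_arcs[OF G a'(1)]
  have far: "tree_dist G a w = tree_dist G a b' + tree_dist G b' w" if w: "w \<in> shadow G a' b'" for w
  proof -
    have wV: "w \<in> pverts G" and wd: "tree_dist G a' w = tree_dist G a' b' + tree_dist G b' w"
      using w by (auto simp: shadow_def)
    have "tree_dist G a' b' \<noteq> 0"
      using b'(2) a'(2) tree_dist_eq_0_iff[OF G verts(1,2)] verts(3) by simp
    then obtain c where c: "(a', c) \<in> parcs G" "tree_dist G a' b' = Suc (tree_dist G c b')"
      using tree_dist_descent[OF G, of a' b'] arcs by (metis tree_dist_self)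
    have "tree_dist G c w \<le> tree_dist G c b' + tree_dist G b' w"
      using tree_dist_triangle[OF G tree_arcs(2)[OF G c(1)] arcs(2) wV] .
    then have "tree_dist G c w \<le> tree_dist G a' w" using wd c(2) by simp
    \<comment> \<open>the step from \<open>a'\<close> toward \<open>w\<close> leads to \<open>c\<close>, so it cannot lead back to \<open>a\<close>\<close>
    then have "\<not> tree_dist G a w \<le> tree_dist G a' w"
      using no_detour_between_closer_neighbours[OF G wV, of a' a c] arcs c a'(2) by auto
    then show ?thesis
      using tree_dist_step[OF G wV a'(1)] wd a'(2) by auto
  qed
  have "w \<in> shadow G a b" if w: "w \<in> shadow G a' b'" for w
  proof -
    have wV: "w \<in> pverts G" using w by (simp add: shadow_def)
    have "tree_dist G a w \<le> tree_dist G a b + tree_dist G b w"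
      using tree_dist_triangle[OF G verts(1,2) wV] .
    moreover have "tree_dist G b w \<le> Suc (tree_dist G b' w)"
      using tree_dist_step[OF G wV b'(1)] by auto
    ultimately show ?thesis using far[OF w] b'(2) wV by (simp add: shadow_def)
  qed
  moreover have "b \<in> shadow G a b" using verts(2) by (simp add: shadow_def)
  moreover have "b \<notin> shadow G a' b'" using far[of b] b'(2) by auto
  ultimately show ?thesis by blast
qed

lemma nontrivial_tree_neighbour:
  assumes "nontrivial_tree G" "u \<in> pverts G"
  shows "\<exists>w. (u, w) \<in> parcs G"
proof -
  have G: "tree_graph G" and "2 \<le> card (pverts G)" using assms(1) by (auto simp: nontrivial_tree_def)
  then have "\<not> pverts G \<subseteq> {u}" using card_mono[of "{u}" "pverts G"] by auto
  then obtain w where "w \<in> pverts G" "u \<noteq> w" by auto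
  then show ?thesis using tree_dist_descent[OF G assms(2)] by metis
qed

definition step_toward :: "'v pair_pre_digraph \<Rightarrow> 'v \<Rightarrow> 'v \<Rightarrow> 'v" where
  "step_toward G a b = (SOME a'. (a, a') \<in> parcs G \<and> tree_dist G a b = Suc (tree_dist G a' b))"

lemma step_toward:
  assumes "tree_graph G" "a \<in> pverts G" "b \<in> pverts G" "a \<noteq> b"
  shows "(a, step_toward G a b) \<in> parcs G"
    and "tree_dist G a b = Suc (tree_dist G (step_toward G a b) b)"
proof -
  have "\<exists>a'. (a, a') \<in> parcs G \<and> tree_dist G a b = Suc (tree_dist G a' b)"
    using tree_dist_descent[OF assms] by blast
  from someI_ex[OF this] show "(a, step_toward G a b) \<in> parcs G"
    and "tree_dist G a b = Suc (tree_dist G (step_toward G a b) b)"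
    by (simp_all add: step_toward_def)
qed

section \<open>Distance in a product of trees\<close>

text \<open>
  A function that vanishes only at \<open>v\<close>, changes by at most one along an arc and can be decreased at
  every other vertex is the distance to \<open>v\<close>: the second property bounds the length of every walk from
  below, the third yields a walk that attains the bound.
\<close>

lemma gdist_eqI:
  fixes f :: "'v \<Rightarrow> nat"
  assumes wf: "pair_wf_digraph G"
    and zero: "\<And>x. x \<in> pverts G \<Longrightarrow> f x = 0 \<longleftrightarrow> x = v"
    and lipschitz: "\<And>x y. (x, y) \<in> parcs G \<Longrightarrow> f x \<le> Suc (f y)"
    and descent: "\<And>x. x \<in> pverts G \<Longrightarrow> x \<noteq> v \<Longrightarrow> \<exists>y. (x, y) \<in> parcs G \<and> f x = Suc (f y)"
    and x: "x \<in> pverts G"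
  shows "gdist G x v = ereal (real (f x))"
proof -
  interpret pair_wf_digraph G by (fact wf)
  have cost: "awalk_cost (\<lambda>_. 1) p = real (length p)" for p :: "('v \<times> 'v) list"
    by (induction p) auto
  have "f x \<le> length p" if "awalk x p v" for p
    using that
  proof (induction p arbitrary: x)
    case Nil
    then show ?case using zero[of x] by (auto simp: awalk_Nil_iff)
  next
    case (Cons e p)
    then have "(x, snd e) \<in> parcs G" "f (snd e) \<le> length p"
      by (auto simp: awalk_Cons_iff)
    then show ?case using lipschitz by fastforce
  qed
  moreover have "\<exists>p. awalk x p v \<and> length p = f x"
    using x
  proof (induction "f x" arbitrary: x)
    case 0
    then have "x = v" using zero by simp
    then show ?case using 0 by (intro exI[of _ "[]"]) (simp add: awalk_Nil_iff)
  next
    case (Suc m)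
    then have "x \<noteq> v" using zero by fastforce
    then obtain y where y: "(x, y) \<in> parcs G" "f x = Suc (f y)" using descent Suc.prems by blast
    then obtain p where "awalk y p v" "length p = f y"
      using Suc.hyps in_arcsD2 by (metis Suc_inject)
    then show ?case using y Suc.prems
      by (intro exI[of _ "(x, y) # p"]) (auto simp: awalk_Cons_iff)
  qed
  ultimately show ?thesis
    unfolding \<mu>_def cost by (intro antisym) (auto intro!: INF_greatest intro: INF_lower2)
qed

locale tree_product =
  fixes I :: "'i set" and T :: "'i \<Rightarrow> 'a pair_pre_digraph"
  assumes finite_index: "finite I"
    and trees: "i \<in> I \<Longrightarrow> nontrivial_tree (T i)"
begin

abbreviation G :: "('i \<Rightarrow> 'a) pair_pre_digraph" where
  "G \<equiv> cartesian_product I T"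

definition pdist :: "('i \<Rightarrow> 'a) \<Rightarrow> ('i \<Rightarrow> 'a) \<Rightarrow> nat" where
  "pdist x y = (\<Sum>i\<in>I. tree_dist (T i) (x i) (y i))"

lemma tree: "i \<in> I \<Longrightarrow> tree_graph (T i)"
  using trees by (simp add: nontrivial_tree_def)

lemma coord_in_verts: "x \<in> pverts G \<Longrightarrow> i \<in> I \<Longrightarrow> x i \<in> pverts (T i)"
  by (auto simp: cartesian_product_def)

lemma upd_in_verts: "x \<in> pverts G \<Longrightarrow> i \<in> I \<Longrightarrow> b \<in> pverts (T i) \<Longrightarrow> x(i := b) \<in> pverts G"
  by (auto simp: cartesian_product_def PiE_iff extensional_def)

lemma verts_eqI: "x \<in> pverts G \<Longrightarrow> y \<in> pverts G \<Longrightarrow> (\<And>i. i \<in> I \<Longrightarrow> x i = y i) \<Longrightarrow> x = y"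
  by (auto simp: cartesian_product_def intro: PiE_ext)

lemma product_arcI:
  assumes "x \<in> pverts G" "i \<in> I" "(x i, b) \<in> parcs (T i)"
  shows "(x, x(i := b)) \<in> parcs G"
  using assms upd_in_verts[OF assms(1,2)] tree_arcs[OF tree[OF assms(2)] assms(3)]
  by (auto simp: cartesian_product_def)

lemma product_arcE:
  assumes "(x, y) \<in> parcs G"
  obtains i b where "x \<in> pverts G" "y \<in> pverts G" "i \<in> I" "(x i, b) \<in> parcs (T i)" "y = x(i := b)"
proof -
  obtain i where i: "x \<in> pverts G" "y \<in> pverts G" "i \<in> I" "(x i, y i) \<in> parcs (T i)"
    "\<forall>j\<in>I. j \<noteq> i \<longrightarrow> x j = y j"
    using assms by (auto simp: cartesian_product_def)
  have "y = x(i := y i)"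
    using i upd_in_verts[OF i(1,3), of "y i"] coord_in_verts by (intro verts_eqI) auto
  then show ?thesis using that i by blast
qed

lemma product_wf: "pair_wf_digraph G"
  by unfold_locales (auto elim: product_arcE)

lemma pdist_commute: "x \<in> pverts G \<Longrightarrow> y \<in> pverts G \<Longrightarrow> pdist x y = pdist y x"
  unfolding pdist_def using tree_dist_commute[OF tree] coord_in_verts by (intro sum.cong) auto

lemma pdist_upd:
  assumes "i \<in> I"
  shows "pdist (x(i := b)) v + tree_dist (T i) (x i) (v i) = pdist x v + tree_dist (T i) b (v i)"
  unfolding pdist_def using finite_index assms by (simp add: sum.remove[of I i])

lemma pdist_eq_0_iff:
  assumes "x \<in> pverts G" "v \<in> pverts G"
  shows "pdist x v = 0 \<longleftrightarrow> x = v"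
proof -
  have "pdist x v = 0 \<longleftrightarrow> (\<forall>i\<in>I. x i = v i)"
    unfolding pdist_def using finite_index tree_dist_eq_0_iff[OF tree] coord_in_verts assms by simp
  then show ?thesis using verts_eqI[OF assms] by auto
qed

lemma pdist_arc:
  assumes "(x, y) \<in> parcs G" "v \<in> pverts G"
  shows "pdist y v = Suc (pdist x v) \<or> pdist x v = Suc (pdist y v)"
  using assms(1)
proof (cases rule: product_arcE)
  case (1 i b)
  then show ?thesis
    using tree_dist_step[OF tree coord_in_verts[OF assms(2)], of i "x i" b] pdist_upd[of i x b v]
    by auto
qed

lemma pdist_step_toward:
  assumes "x \<in> pverts G" "v \<in> pverts G" "i \<in> I" "x i \<noteq> v i"
  shows "(x, x(i := step_toward (T i) (x i) (v i))) \<in> parcs G"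
    and "pdist x v = Suc (pdist (x(i := step_toward (T i) (x i) (v i))) v)"
proof -
  note step = step_toward[OF tree[OF assms(3)] coord_in_verts[OF assms(1,3)]
      coord_in_verts[OF assms(2,3)] assms(4)]
  show "(x, x(i := step_toward (T i) (x i) (v i))) \<in> parcs G"
    using product_arcI[OF assms(1,3) step(1)] .
  show "pdist x v = Suc (pdist (x(i := step_toward (T i) (x i) (v i))) v)"
    using pdist_upd[OF assms(3), of x "step_toward (T i) (x i) (v i)" v] step(2) by simp
qed

text \<open>
  Distances add up over the coordinates.  This is what turns the game into arithmetic: a zombie's move
  brings it one step closer in some coordinate in which it differs from the survivor, and any such
  coordinate may be chosen.
\<close>

lemma gdist_product:
  fixes x v :: "'i \<Rightarrow> 'a"
  assumes "x \<in> pverts G" "v \<in> pverts G"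
  shows "gdist G x v = ereal (real (pdist x v))"
proof (rule gdist_eqI[where f = "\<lambda>x. pdist x v", OF product_wf _ _ _ assms(1)])
  fix x y :: "'i \<Rightarrow> 'a"
  show "pdist x v = 0 \<longleftrightarrow> x = v" if "x \<in> pverts G"
    using pdist_eq_0_iff[OF that assms(2)] by simp
  show "pdist x v \<le> Suc (pdist y v)" if "(x, y) \<in> parcs G"
    using pdist_arc[OF that assms(2)] by auto
  show "\<exists>y. (x, y) \<in> parcs G \<and> pdist x v = Suc (pdist y v)" if x: "x \<in> pverts G" "x \<noteq> v"
  proof -
    obtain i where "i \<in> I" "x i \<noteq> v i" using verts_eqI[OF x(1) assms(2)] x(2) by auto
    then show ?thesis using pdist_step_toward[OF x(1) assms(2)] by blast
  qed
qed

lemma zombies_move_product: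
  assumes "v \<in> pverts G"
  shows "zombies_move G v Z Z' \<longleftrightarrow> list_all2 (\<lambda>x y. (x, y) \<in> parcs G \<and> pdist x v = Suc (pdist y v)) Z Z'"
proof -
  have "((x, y) \<in> parcs G \<and> gdist G y v < gdist G x v) \<longleftrightarrow>
      ((x, y) \<in> parcs G \<and> pdist x v = Suc (pdist y v))" for x y
  proof -
    have "gdist G y v < gdist G x v \<longleftrightarrow> pdist x v = Suc (pdist y v)" if xy: "(x, y) \<in> parcs G"
    proof -
      have "x \<in> pverts G" "y \<in> pverts G" using xy by (auto elim: product_arcE)
      then show ?thesis using gdist_product[OF _ assms] pdist_arc[OF xy assms] by auto
    qed
    then show ?thesis by blast
  qed
  then show ?thesis by (simp add: zombies_move_def)
qed

end

section \<open>Invariants that decide the game\<close>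

text \<open>
  The survivor wins if there is a condition that holds after a suitable initial choice and can be
  restored after any legal reply of the zombies.  Against a given strategy \<open>\<sigma>\<close>, the survivor's play is
  built by recursion; the recursion produces histories rather than single positions since \<open>\<sigma>\<close> sees the
  whole history.
\<close>

lemma no_winning_zombie_strategyI:
  fixes Safe :: "'v list \<Rightarrow> 'v \<Rightarrow> bool"
  assumes start: "\<And>Z. length Z = k \<Longrightarrow> set Z \<subseteq> pverts G \<Longrightarrow> \<exists>v\<in>pverts G. Safe Z v"
    and free: "\<And>Z v. Safe Z v \<Longrightarrow> v \<notin> set Z"
    and step: "\<And>Z v Z'. Safe Z v \<Longrightarrow> zombies_move G v Z Z' \<Longrightarrow>
      v \<notin> set Z' \<and> (\<exists>v'. (v' = v \<or> (v, v') \<in> parcs G) \<and> Safe Z' v')"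
  shows "\<not> winning_zombie_strategy G k \<sigma>"
proof
  assume win: "winning_zombie_strategy G k \<sigma>"
  then obtain v0 where v0: "v0 \<in> pverts G" "Safe (\<sigma> []) v0"
    using start[of "\<sigma> []"] by (auto simp: winning_zombie_strategy_def)
  \<comment> \<open>staying put as the default keeps the play legal even where no safe move exists\<close>
  define dodge where "dodge Z v = (if \<exists>v'. (v' = v \<or> (v, v') \<in> parcs G) \<and> Safe Z v'
      then SOME v'. (v' = v \<or> (v, v') \<in> parcs G) \<and> Safe Z v' else v)" for Z v
  define hist where "hist = rec_nat [v0] (\<lambda>_ h. h @ [dodge (\<sigma> h) (last h)])"
  define s where "s t = last (hist t)" for t
  have hist: "map s [0..<Suc t] = hist t" for t
    by (induction t) (simp_all add: s_def hist_def)
  have s0: "s 0 = v0" by (simp add: s_def hist_def)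
  have sSuc: "s (Suc t) = dodge (zombies_at \<sigma> s (Suc t)) (s t)" for t
    unfolding zombies_at_def hist by (simp add: s_def hist_def)
  have dodge: "(dodge Z v = v \<or> (v, dodge Z v) \<in> parcs G) \<and> Safe Z (dodge Z v)"
    if "\<exists>v'. (v' = v \<or> (v, v') \<in> parcs G) \<and> Safe Z v'" for Z v
    using someI_ex[OF that] that unfolding dodge_def by simp
  have "dodge Z v = v \<or> (v, dodge Z v) \<in> parcs G" for Z v
    using dodge by (cases "\<exists>v'. (v' = v \<or> (v, v') \<in> parcs G) \<and> Safe Z v'") (auto simp: dodge_def)
  then have play: "survivor_play G s"
    using v0 by (simp add: survivor_play_def s0 sSuc)
  have "\<not> captured_by (zombies_at \<sigma> s) s t \<and> Safe (zombies_at \<sigma> s t) (s t)" for t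
  proof (induction t)
    case 0
    then show ?case using v0 free by (auto simp: captured_by_def zombies_at_def s0)
  next
    case (Suc t)
    then have "zombies_move G (s t) (zombies_at \<sigma> s t) (zombies_at \<sigma> s (Suc t))"
      using win play by (auto simp: winning_zombie_strategy_def)
    with Suc step have "s t \<notin> set (zombies_at \<sigma> s (Suc t))"
      "\<exists>v'. (v' = s t \<or> (s t, v') \<in> parcs G) \<and> Safe (zombies_at \<sigma> s (Suc t)) v'"
      by blast+
    moreover from this have "Safe (zombies_at \<sigma> s (Suc t)) (s (Suc t))"
      using dodge by (simp add: sSuc)
    ultimately show ?case
      using Suc free by (auto simp: captured_by_def le_Suc_eq less_Suc_eq)
  qed
  then show False using win play by (auto simp: winning_zombie_strategy_def)
qed

text \<open>
  The zombies win if, short of a capture, they can reply such that the positions descend along a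
  well-founded relation.
  \<open>Inv v Z\<close> speaks about the moment after the zombies' turn, so the first round, before which there is
  no such moment, needs a premise of its own.
\<close>

lemma winning_zombie_strategyI:
  fixes Inv :: "'v \<Rightarrow> 'v list \<Rightarrow> bool"
  assumes Z0: "length Z0 = k" "set Z0 \<subseteq> pverts G"
    and start: "\<And>v. v \<in> pverts G \<Longrightarrow> v \<notin> set Z0 \<Longrightarrow>
      \<exists>Z. zombies_move G v Z0 Z \<and> (v \<in> set Z \<or> Inv v Z)"
    and step: "\<And>v Z v'. Inv v Z \<Longrightarrow> v' = v \<or> (v, v') \<in> parcs G \<Longrightarrow> v' \<notin> set Z \<Longrightarrow>
      \<exists>Z'. zombies_move G v' Z Z' \<and> (v' \<in> set Z' \<or> Inv v' Z' \<and> ((v', Z'), (v, Z)) \<in> R)"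
    and R: "wf R"
  shows "\<exists>\<sigma>. winning_zombie_strategy G k \<sigma>"
proof -
  define first where "first v = (SOME Z. zombies_move G v Z0 Z \<and> (v \<in> set Z \<or> Inv v Z))" for v
  define reply where "reply v Z v' =
    (SOME Z'. zombies_move G v' Z Z' \<and> (v' \<in> set Z' \<or> Inv v' Z' \<and> ((v', Z'), (v, Z)) \<in> R))"
    for v Z v'
  \<comment> \<open>the state consists of the survivor's last position, if any, and the zombies\<close>
  define respond where "respond st v' =
    (Some v', case fst st of None \<Rightarrow> first v' | Some v \<Rightarrow> reply v (snd st) v')" for st v'
  define \<sigma> where "\<sigma> h = snd (foldl respond (None, Z0) h)" for h
  have first: "zombies_move G v Z0 (first v) \<and> (v \<in> set (first v) \<or> Inv v (first v))"
    if "v \<in> pverts G" "v \<notin> set Z0" for v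
    using someI_ex[OF start[OF that]] by (simp add: first_def)
  have reply: "zombies_move G v' Z (reply v Z v') \<and> (v' \<in> set (reply v Z v') \<or>
      Inv v' (reply v Z v') \<and> ((v', reply v Z v'), (v, Z)) \<in> R)"
    if "Inv v Z" "v' = v \<or> (v, v') \<in> parcs G" "v' \<notin> set Z" for v Z v'
    using someI_ex[OF step[OF that]] by (simp add: reply_def)
  have "(\<forall>t. \<not> captured_by (zombies_at \<sigma> s) s t \<longrightarrow>
              zombies_move G (s t) (zombies_at \<sigma> s t) (zombies_at \<sigma> s (Suc t))) \<and>
        (\<exists>t. captured_by (zombies_at \<sigma> s) s t)" if play: "survivor_play G s" for s
  proof -
    let ?Z = "zombies_at \<sigma> s"
    have state: "foldl respond (None, Z0) (map s [0..<Suc t]) = (Some (s t), ?Z (Suc t))" for t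
      by (simp add: zombies_at_def \<sigma>_def respond_def)
    have Zstart: "?Z 0 = Z0" by (simp add: zombies_at_def \<sigma>_def)
    have Zone: "?Z (Suc 0) = first (s 0)" by (simp add: zombies_at_def \<sigma>_def respond_def)
    have Zstep: "?Z (Suc (Suc t)) = reply (s t) (?Z (Suc t)) (s (Suc t))" for t
    proof -
      have "[0..<Suc (Suc t)] = [0..<Suc t] @ [Suc t]" by simp
      then have "foldl respond (None, Z0) (map s [0..<Suc (Suc t)]) =
          respond (Some (s t), ?Z (Suc t)) (s (Suc t))"
        using state[of t] by (simp only: map_append foldl_append) simp
      then show ?thesis unfolding state by (simp add: respond_def)
    qed
    have uncaught: "s t \<notin> set (?Z t)" if "\<not> captured_by ?Z s t" for t
      using that by (auto simp: captured_by_def)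
    have caught: "captured_by ?Z s (Suc t)" if "s t \<in> set (?Z (Suc t))" for t
      using that by (auto simp: captured_by_def)
    have earlier: "\<not> captured_by ?Z s t" if "\<not> captured_by ?Z s (Suc t)" for t
      using that le_SucI less_SucI unfolding captured_by_def by blast
    have legal: "zombies_move G (s t) (?Z t) (?Z (Suc t)) \<and>
        (s t \<in> set (?Z (Suc t)) \<or> Inv (s t) (?Z (Suc t)))" if "\<not> captured_by ?Z s t" for t
      using that
    proof (induction t)
      case 0
      then show ?case
        using first[of "s 0"] uncaught[of 0] play by (simp add: Zstart Zone survivor_play_def)
    next
      case (Suc t)
      then have "Inv (s t) (?Z (Suc t))" using earlier caught by blast
      then show ?case
        using reply[of "s t" "?Z (Suc t)" "s (Suc t)"] play uncaught[OF Suc.prems]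
        by (auto simp: Zstep survivor_play_def)
    qed
    moreover have "\<exists>t. captured_by ?Z s t"
    proof (rule ccontr)
      assume never: "\<nexists>t. captured_by ?Z s t"
      have "((s (Suc t), ?Z (Suc (Suc t))), (s t, ?Z (Suc t))) \<in> R" for t
        using reply[of "s t" "?Z (Suc t)" "s (Suc t)"] never play legal[of t] uncaught[of "Suc t"]
          caught[of t] caught[of "Suc t"]
        by (auto simp: Zstep survivor_play_def)
      then show False
        using wf_no_infinite_down_chainE[OF R, of "\<lambda>t. (s t, ?Z (Suc t))"] by blast
    qed
    ultimately show ?thesis by blast
  qed
  moreover have "\<sigma> [] = Z0" by (simp add: \<sigma>_def)
  ultimately have "winning_zombie_strategy G k \<sigma>"
    using Z0 by (simp add: winning_zombie_strategy_def)
  then show ?thesis by blast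
qed

context tree_product
begin

section \<open>Too few zombies\<close>

text \<open>
  By moving to \<open>e i\<close> in coordinate \<open>i\<close> the survivor runs into danger from \<open>z\<close> only if this decreases the
  distance to at most 1.  Then \<open>z\<close> is at distance at most 2 and differs from the survivor in coordinate
  \<open>i\<close>; a zombie at distance \<open>d\<close> differs in at most \<open>d\<close> coordinates.
\<close>

lemma card_dangerous_coordinates:
  assumes z: "z \<in> pverts G" and v: "v \<in> pverts G" "z \<noteq> v"
    and e: "\<And>i. i \<in> I \<Longrightarrow> (v i, e i) \<in> parcs (T i)"
  shows "card {i \<in> I. pdist z (v(i := e i)) \<le> 1} \<le> (if odd (pdist z v) then 1 else 2)"
proof -
  let ?D = "{i \<in> I. pdist z (v(i := e i)) \<le> 1}"
  have arc: "(v, v(i := e i)) \<in> parcs G" if "i \<in> I" for i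
    using product_arcI[OF v(1) that e[OF that]] .
  have dist: "pdist z (v(i := e i)) = Suc (pdist z v) \<or> pdist z v = Suc (pdist z (v(i := e i)))"
    if "i \<in> I" for i
    using pdist_arc[OF arc[OF that] z] arc[OF that]
    by (auto simp: pdist_commute[OF z] v elim: product_arcE)
  have pos: "0 < pdist z v" using pdist_eq_0_iff[OF z v(1)] v(2) by simp
  have differ: "1 \<le> tree_dist (T i) (z i) (v i)" if i: "i \<in> ?D" for i
  proof (rule ccontr)
    assume "\<not> ?thesis"
    then have "tree_dist (T i) (z i) (v i) = 0" by simp
    moreover have iI: "i \<in> I" using i by simp
    ultimately have "z i = v i"
      using tree_dist_eq_0_iff[OF tree[OF iI] coord_in_verts[OF z iI] coord_in_verts[OF v(1) iI]]
      by simp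
    have "v(i := e i) \<in> pverts G" using arc[OF iI] by (auto elim: product_arcE)
    then have "pdist z (v(i := e i)) = pdist z v + tree_dist (T i) (e i) (v i)"
      using pdist_upd[OF iI, of v "e i" z] pdist_commute[OF z] v(1) \<open>z i = v i\<close> by simp
    then show False using dist[OF iI] pos i by auto
  qed
  have "card ?D = (\<Sum>i\<in>?D. 1)" by simp
  also have "\<dots> \<le> (\<Sum>i\<in>?D. tree_dist (T i) (z i) (v i))"
    using differ by (intro sum_mono) auto
  also have "\<dots> \<le> pdist z v"
    unfolding pdist_def using finite_index by (intro sum_mono2) auto
  finally have "card ?D \<le> pdist z v" .
  moreover have "pdist z v \<le> 2" if "i \<in> ?D" for i
    using that dist[of i] by auto
  moreover have "card ?D = 0" if "?D = {}" using that by (metis card.empty)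
  ultimately have "card ?D \<le> pdist z v" "card ?D = 0 \<or> pdist z v \<le> 2" by blast+
  then show ?thesis using pos by (cases "pdist z v = 1"; cases "pdist z v = 2") auto
qed

definition num_even :: "('i \<Rightarrow> 'a) list \<Rightarrow> ('i \<Rightarrow> 'a) \<Rightarrow> nat" where
  "num_even Z v = card {j. j < length Z \<and> even (pdist (Z ! j) v)}"

definition num_odd :: "('i \<Rightarrow> 'a) list \<Rightarrow> ('i \<Rightarrow> 'a) \<Rightarrow> nat" where
  "num_odd Z v = card {j. j < length Z \<and> odd (pdist (Z ! j) v)}"

lemma num_even_odd: "num_even Z v + num_odd Z v = length Z"
proof -
  have "{j. j < length Z \<and> even (pdist (Z ! j) v)} \<union> {j. j < length Z \<and> odd (pdist (Z ! j) v)}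
    = {..<length Z}" by auto
  then show ?thesis
    unfolding num_even_def num_odd_def by (subst card_Un_disjoint[symmetric]) auto
qed

text \<open>
  A move along an arc changes the parity of every distance.  Hence, as long as the survivor never
  passes, the parities after the zombies' turns stay what they are.
\<close>

lemma num_even_arc:
  assumes "(v, v') \<in> parcs G" "set Z \<subseteq> pverts G"
  shows "num_even Z v' = num_odd Z v"
proof -
  have "even (pdist z v') \<longleftrightarrow> odd (pdist z v)" if "z \<in> set Z" for z
  proof -
    have z: "z \<in> pverts G" using that assms(2) by blast
    have "v \<in> pverts G" "v' \<in> pverts G" using assms(1) by (auto elim: product_arcE)
    then show ?thesis
      using pdist_arc[OF assms(1) z] by (auto simp: pdist_commute[OF z])
  qed
  then show ?thesis unfolding num_even_def num_odd_def by (metis nth_mem)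
qed

text \<open>
  The survivor's invariant after the survivor's turn.  Distance 2 means that no zombie can capture on
  its next move, and that at least half of the distances are even means that they are odd after that
  move, when they matter for \<open>card_dangerous_coordinates\<close>.
\<close>

definition survivor_safe :: "('i \<Rightarrow> 'a) list \<Rightarrow> ('i \<Rightarrow> 'a) \<Rightarrow> bool" where
  "survivor_safe Z v \<longleftrightarrow> set Z \<subseteq> pverts G \<and> v \<in> pverts G \<and> 3 * length Z < 2 * card I \<and>
     (\<forall>z\<in>set Z. 2 \<le> pdist z v) \<and> length Z \<le> 2 * num_even Z v"

lemma product_vertex: "\<exists>u. u \<in> pverts G"
proof -
  have "(SOME a. a \<in> pverts (T i)) \<in> pverts (T i)" if "i \<in> I" for i
  proof -
    have "pverts (T i) \<noteq> {}" using trees[OF that] by (auto simp: nontrivial_tree_def)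
    then show ?thesis by (simp add: some_in_eq)
  qed
  then have "(\<lambda>i\<in>I. SOME a. a \<in> pverts (T i)) \<in> pverts G"
    by (simp add: cartesian_product_def)
  then show ?thesis by blast
qed

lemma neighbour_function:
  assumes "v \<in> pverts G"
  obtains e where "\<And>i. i \<in> I \<Longrightarrow> (v i, e i) \<in> parcs (T i)"
  using nontrivial_tree_neighbour[OF trees coord_in_verts[OF assms]] by metis

text \<open>
  The zombies at odd distance block at most one coordinate each, the others at most two.  As at least
  half of them are at odd distance, \<open>k\<close> zombies block at most \<open>3 * k / 2\<close> coordinates, which is less
  than the number of coordinates.
\<close>

lemma survivor_has_safe_move:
  assumes Z: "set Z \<subseteq> pverts G" "3 * length Z < 2 * card I" "length Z \<le> 2 * num_odd Z v"
    and v: "v \<in> pverts G" "v \<notin> set Z"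
  shows "\<exists>v'. (v, v') \<in> parcs G \<and> survivor_safe Z v'"
proof -
  obtain e where e: "\<And>i. i \<in> I \<Longrightarrow> (v i, e i) \<in> parcs (T i)"
    using neighbour_function[OF v(1)] by blast
  let ?D = "\<lambda>j. {i \<in> I. pdist (Z ! j) (v(i := e i)) \<le> 1}"
  let ?J = "{..<length Z}"
  have "card (\<Union>j\<in>?J. ?D j) \<le> (\<Sum>j\<in>?J. card (?D j))"
    by (rule card_UN_le) simp
  also have "\<dots> \<le> (\<Sum>j\<in>?J. if odd (pdist (Z ! j) v) then 1 else 2)"
    using Z(1) v nth_mem by (intro sum_mono card_dangerous_coordinates e) fastforce+
  also have "\<dots> = num_odd Z v + 2 * num_even Z v"
    by (simp add: sum.If_cases num_odd_def num_even_def Collect_conj_eq[symmetric] Int_def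
        cong: conj_cong)
  also have "\<dots> < card I"
    using Z(2,3) num_even_odd[of Z v] by linarith
  finally have "\<not> I \<subseteq> (\<Union>j\<in>?J. ?D j)"
    using card_mono[of "\<Union>j\<in>?J. ?D j" I] finite_index by fastforce
  then obtain i where i: "i \<in> I" "\<And>j. j < length Z \<Longrightarrow> 2 \<le> pdist (Z ! j) (v(i := e i))"
    by fastforce
  have arc: "(v, v(i := e i)) \<in> parcs G" using product_arcI[OF v(1) i(1) e[OF i(1)]] .
  moreover have "survivor_safe Z (v(i := e i))"
    using i arc Z num_even_arc[OF arc Z(1)]
    by (auto simp: survivor_safe_def in_set_conv_nth elim: product_arcE)
  ultimately show ?thesis by blast
qed

text \<open>
  An initial vertex is found by pretending to make a move.  The survivor imagines standing at an
  unoccupied vertex with enough zombies at odd distance and takes the safe move from there.  Such a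
  vertex is a neighbour of a vertex \<open>w\<close> from which at least half of the distances are even: \<open>w\<close> can be
  any vertex \<open>u\<close> or else a neighbour of \<open>u\<close>, and \<open>w\<close> has more neighbours than there are zombies.
\<close>

lemma survivor_can_start:
  assumes Z: "set Z \<subseteq> pverts G" "3 * length Z < 2 * card I"
  shows "\<exists>v\<in>pverts G. survivor_safe Z v"
proof -
  obtain u where u: "u \<in> pverts G" using product_vertex by blast
  have "I \<noteq> {}" using Z(2) by auto
  obtain w where w: "w \<in> pverts G" "length Z \<le> 2 * num_even Z w"
  proof (cases "length Z \<le> 2 * num_even Z u")
    case False
    obtain i where "i \<in> I" using \<open>I \<noteq> {}\<close> by blast
    obtain e where "\<And>i. i \<in> I \<Longrightarrow> (u i, e i) \<in> parcs (T i)"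
      using neighbour_function[OF u] by blast
    then have arc: "(u, u(i := e i)) \<in> parcs G"
      using product_arcI[OF u \<open>i \<in> I\<close>] \<open>i \<in> I\<close> by blast
    then have "u(i := e i) \<in> pverts G" by (auto elim: product_arcE)
    then show ?thesis
      using that[of "u(i := e i)"] False num_even_arc[OF arc Z(1)] num_even_odd[of Z u] by simp
  qed (use u that in blast)
  obtain e where e: "\<And>i. i \<in> I \<Longrightarrow> (w i, e i) \<in> parcs (T i)"
    using neighbour_function[OF w(1)] by blast
  have "inj_on (\<lambda>i. w(i := e i)) I"
  proof (rule inj_onI, rule ccontr)
    fix i j assume ij: "i \<in> I" "w(i := e i) = w(j := e j)" "i \<noteq> j"
    then have "e i = w i" by (metis fun_upd_apply)
    then show False using tree_arcs(3)[OF tree[OF ij(1)] e[OF ij(1)]] by simp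
  qed
  then have "card ((\<lambda>i. w(i := e i)) ` I) = card I" by (rule card_image)
  moreover have "card (set Z) < card I" using card_length[of Z] Z(2) by linarith
  ultimately have "\<not> (\<lambda>i. w(i := e i)) ` I \<subseteq> set Z"
    using card_mono[of "set Z" "(\<lambda>i. w(i := e i)) ` I"] by auto
  then obtain i where i: "i \<in> I" "w(i := e i) \<notin> set Z" by blast
  have arc: "(w, w(i := e i)) \<in> parcs G" using product_arcI[OF w(1) i(1) e[OF i(1)]] .
  then have "(w(i := e i), w) \<in> parcs G" "w(i := e i) \<in> pverts G"
    using product_arcI[of "w(i := e i)" i "w i"] tree_arcs(4)[OF tree[OF i(1)] e[OF i(1)]] i(1)
    by (auto elim: product_arcE)
  then have "num_even Z w = num_odd Z (w(i := e i))" using num_even_arc[OF _ Z(1)] by blast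
  then obtain v where "survivor_safe Z v"
    using survivor_has_safe_move[OF Z, of "w(i := e i)"] w(2) i(2) \<open>w(i := e i) \<in> pverts G\<close> by auto
  then show ?thesis by (auto simp: survivor_safe_def)
qed

lemma survivor_can_continue:
  assumes safe: "survivor_safe Z v" and move: "zombies_move G v Z Z'"
  shows "v \<notin> set Z' \<and> (\<exists>v'. (v, v') \<in> parcs G \<and> survivor_safe Z' v')"
proof -
  have v: "v \<in> pverts G" using safe by (simp add: survivor_safe_def)
  have len: "length Z' = length Z"
    and step: "\<And>j. j < length Z \<Longrightarrow> (Z ! j, Z' ! j) \<in> parcs G \<and>
      pdist (Z ! j) v = Suc (pdist (Z' ! j) v)"
    using move unfolding zombies_move_product[OF v] by (auto simp: list_all2_conv_all_nth)
  have Z': "set Z' \<subseteq> pverts G"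
    using step len by (fastforce simp: in_set_conv_nth elim: product_arcE)
  have odd: "num_odd Z' v = num_even Z v"
    unfolding num_odd_def num_even_def len using step by (intro arg_cong[where f = card]) auto
  have "1 \<le> pdist z v" if z: "z \<in> set Z'" for z
  proof -
    obtain j where j: "j < length Z" "z = Z' ! j" using z len by (metis in_set_conv_nth)
    moreover have "2 \<le> pdist (Z ! j) v" using safe j(1) by (simp add: survivor_safe_def)
    ultimately show ?thesis using step[OF j(1)] by simp
  qed
  then have "v \<notin> set Z'" using pdist_eq_0_iff[OF v v] by fastforce
  moreover have "\<exists>v'. (v, v') \<in> parcs G \<and> survivor_safe Z' v'"
    using survivor_has_safe_move[OF Z' _ _ v] \<open>v \<notin> set Z'\<close> safe odd len
    by (simp add: survivor_safe_def)
  ultimately show ?thesis by blast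
qed

theorem few_zombies_lose:
  assumes "3 * k < 2 * card I"
  shows "\<not> winning_zombie_strategy G k \<sigma>"
proof (rule no_winning_zombie_strategyI[where Safe = survivor_safe])
  show "\<exists>v\<in>pverts G. survivor_safe Z v" if "length Z = k" "set Z \<subseteq> pverts G" for Z
    using survivor_can_start that assms by blast
  show "v \<notin> set Z" if "survivor_safe Z v" for Z v
    using that pdist_eq_0_iff[of v v] by (fastforce simp: survivor_safe_def)
  show "v \<notin> set Z' \<and> (\<exists>v'. (v' = v \<or> (v, v') \<in> parcs G) \<and> survivor_safe Z' v')"
    if "survivor_safe Z v" "zombies_move G v Z Z'" for Z v Z'
    using survivor_can_continue[OF that] by blast
qed

section \<open>Enough zombies\<close>

text \<open>
  Up to a common shift, the parity of a zombie's distance is that of its index.  So whatever the shift,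
  at least half of the zombies, rounded down, are at even distance.
\<close>

definition alternating :: "('i \<Rightarrow> 'a) list \<Rightarrow> ('i \<Rightarrow> 'a) \<Rightarrow> bool" where
  "alternating Z v \<longleftrightarrow> (\<exists>c. \<forall>j<length Z. even (pdist (Z ! j) v + j + c))"

definition zombie_reply ::
    "('i \<Rightarrow> 'a) \<Rightarrow> (nat \<Rightarrow> 'i) \<Rightarrow> ('i \<Rightarrow> 'a) list \<Rightarrow> ('i \<Rightarrow> 'a) list" where
  "zombie_reply v c Z =
     map (\<lambda>j. (Z ! j)(c j := step_toward (T (c j)) ((Z ! j) (c j)) (v (c j)))) [0..<length Z]"

lemma length_zombie_reply [simp]: "length (zombie_reply v c Z) = length Z"
  by (simp add: zombie_reply_def)

lemma zombie_reply_legal: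
  assumes Z: "set Z \<subseteq> pverts G" and v: "v \<in> pverts G"
    and c: "\<And>j. j < length Z \<Longrightarrow> c j \<in> I \<and> (Z ! j) (c j) \<noteq> v (c j)"
  shows "zombies_move G v Z (zombie_reply v c Z)"
    and "set (zombie_reply v c Z) \<subseteq> pverts G"
    and "\<And>j. j < length Z \<Longrightarrow> pdist (Z ! j) v = Suc (pdist (zombie_reply v c Z ! j) v)"
proof -
  have step: "(Z ! j, zombie_reply v c Z ! j) \<in> parcs G \<and>
      pdist (Z ! j) v = Suc (pdist (zombie_reply v c Z ! j) v)" if "j < length Z" for j
  proof -
    have "Z ! j \<in> pverts G" using that Z nth_mem by blast
    then show ?thesis
      using pdist_step_toward[of "Z ! j" v "c j"] v c[OF that] that by (simp add: zombie_reply_def)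
  qed
  then show "zombies_move G v Z (zombie_reply v c Z)"
    unfolding zombies_move_product[OF v] by (simp add: list_all2_conv_all_nth)
  show "set (zombie_reply v c Z) \<subseteq> pverts G"
    using step by (fastforce simp: in_set_conv_nth elim: product_arcE)
  show "\<And>j. j < length Z \<Longrightarrow> pdist (Z ! j) v = Suc (pdist (zombie_reply v c Z ! j) v)"
    using step by blast
qed

text \<open>
  In one round, a passing survivor changes the parity of all distances, a moving one of none.
\<close>

lemma alternating_round:
  assumes Z: "set Z \<subseteq> pverts G" "alternating Z v" "length Z' = length Z"
    and v': "v' = v \<or> (v, v') \<in> parcs G"
    and Z': "\<And>j. j < length Z \<Longrightarrow> pdist (Z ! j) v' = Suc (pdist (Z' ! j) v')"
  shows "alternating Z' v'"
proof -
  obtain c where c: "\<And>j. j < length Z \<Longrightarrow> even (pdist (Z ! j) v + j + c)"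
    using Z(2) by (auto simp: alternating_def)
  from v' show ?thesis
  proof
    assume "v' = v"
    then have "even (pdist (Z' ! j) v' + j + Suc c)" if "j < length Z" for j
      using c[OF that] Z'[OF that] \<open>v' = v\<close> by (auto simp: even_add)
    then show ?thesis using Z(3) unfolding alternating_def by (intro exI[of _ "Suc c"]) simp
  next
    assume arc: "(v, v') \<in> parcs G"
    then have verts: "v \<in> pverts G" "v' \<in> pverts G" by (auto elim: product_arcE)
    have "even (pdist (Z' ! j) v' + j + c)" if "j < length Z" for j
    proof -
      have z: "Z ! j \<in> pverts G" using that Z(1) nth_mem by blast
      have "pdist (Z ! j) v' = Suc (pdist (Z ! j) v) \<or> pdist (Z ! j) v = Suc (pdist (Z ! j) v')"
        using pdist_arc[OF arc z] by (simp add: pdist_commute[OF z] verts)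
      then show ?thesis using c[OF that] Z'[OF that] by auto
    qed
    then show ?thesis using Z(3) unfolding alternating_def by (intro exI[of _ c]) simp
  qed
qed

text \<open>
  The zombies' progress is measured lexicographically by the following three quantities: the sum of all
  distances, the number of coordinates in which no zombie differs from the survivor, and the room that
  the trees leave for running away from the zombies in single coordinates.
\<close>

definition total_dist :: "('i \<Rightarrow> 'a) list \<Rightarrow> ('i \<Rightarrow> 'a) \<Rightarrow> nat" where
  "total_dist Z v = (\<Sum>j<length Z. pdist (Z ! j) v)"

definition unguarded :: "('i \<Rightarrow> 'a) list \<Rightarrow> ('i \<Rightarrow> 'a) \<Rightarrow> 'i set" where
  "unguarded Z v = {i \<in> I. \<forall>j<length Z. (Z ! j) i = v i}"

definition room :: "('i \<Rightarrow> 'a) list \<Rightarrow> ('i \<Rightarrow> 'a) \<Rightarrow> nat" where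
  "room Z v = (\<Sum>j<length Z. \<Sum>i\<in>I. card (shadow (T i) ((Z ! j) i) (v i)))"

definition progress where
  "progress = measures [\<lambda>(v, Z). total_dist Z v, \<lambda>(v, Z). card (unguarded Z v), \<lambda>(v, Z). room Z v]"

text \<open>
  Two zombies with consecutive indices are at distances of different parity, hence at total distance
  at least 3.
\<close>

lemma sum_alternating_ge:
  fixes p :: "nat \<Rightarrow> nat"
  assumes "\<And>j. j < k \<Longrightarrow> 0 < p j" "\<And>j. j < k \<Longrightarrow> even (p j + j + c)"
  shows "k + k div 2 \<le> (\<Sum>j<k. p j)"
  using assms
proof (induction k rule: induct_nat_012)
  case (ge2 k)
  have "0 < p k" "0 < p (Suc k)" "even (p k + k + c)" "even (p (Suc k) + Suc k + c)"
    using ge2.prems by auto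
  moreover from this have "p k + p (Suc k) \<noteq> 2"
    by (cases "p k = 1"; cases "p (Suc k) = 1") auto
  ultimately have "3 \<le> p k + p (Suc k)" by linarith
  moreover have "k + k div 2 \<le> (\<Sum>j<k. p j)" using ge2 by simp
  ultimately show ?case by simp
qed auto

lemma total_dist_conv_coordinates:
  "total_dist Z v = (\<Sum>i\<in>I. \<Sum>j<length Z. tree_dist (T i) ((Z ! j) i) (v i))"
  unfolding total_dist_def pdist_def by (rule sum.swap)

text \<open>
  A pigeonhole argument: the distances, added up by coordinates, amount to at least \<open>card I\<close>, although
  coordinate \<open>l\<close> contributes nothing.
\<close>

lemma doubly_guarded_coordinate:
  assumes "card I \<le> total_dist Z v" "l \<in> unguarded Z v"
  shows "\<exists>i\<in>I - {l}. 2 \<le> (\<Sum>j<length Z. tree_dist (T i) ((Z ! j) i) (v i))"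
proof (rule ccontr)
  let ?col = "\<lambda>i. \<Sum>j<length Z. tree_dist (T i) ((Z ! j) i) (v i)"
  assume none: "\<not> ?thesis"
  have "?col i \<le> 1" if "i \<in> I - {l}" for i
  proof -
    have "\<not> 2 \<le> ?col i" using none that by blast
    then show ?thesis by linarith
  qed
  then have "sum ?col (I - {l}) \<le> card (I - {l})" using sum_mono[of "I - {l}" ?col "\<lambda>_. 1"] by simp
  moreover have "l \<in> I" "?col l = 0" using assms(2) by (auto simp: unguarded_def)
  moreover have "total_dist Z v = ?col l + sum ?col (I - {l})"
    unfolding total_dist_conv_coordinates using finite_index \<open>l \<in> I\<close> by (simp add: sum.remove)
  moreover have "card (I - {l}) < card I" using finite_index \<open>l \<in> I\<close> by (rule card_Diff1_less)
  ultimately show False using assms(1) by simp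
qed

text \<open>
  If the survivor passes or moves toward some zombie, any reply decreases the sum of the distances: a
  zombie's move makes good for the at most one step that it lost, and one zombie did not lose any.
\<close>

lemma progress_when_closer:
  assumes Z: "set Z \<subseteq> pverts G" and v: "v \<in> pverts G"
    and v': "v' = v \<or> (v, v') \<in> parcs G"
    and Z': "length Z' = length Z"
      "\<And>j. j < length Z \<Longrightarrow> pdist (Z ! j) v' = Suc (pdist (Z' ! j) v')"
    and j0: "j0 < length Z" "pdist (Z ! j0) v' \<le> pdist (Z ! j0) v"
  shows "total_dist Z' v' < total_dist Z v"
proof -
  have "pdist (Z' ! j) v' \<le> pdist (Z ! j) v" if j: "j < length Z" for j
  proof -
    have z: "Z ! j \<in> pverts G" using j Z nth_mem by blast
    have "pdist (Z ! j) v' \<le> Suc (pdist (Z ! j) v)"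
      using v'
    proof
      assume arc: "(v, v') \<in> parcs G"
      then have "v' \<in> pverts G" by (auto elim: product_arcE)
      then show ?thesis using pdist_arc[OF arc z] v by (auto simp: pdist_commute[OF z])
    qed simp
    then show ?thesis using Z'(2)[OF j] by simp
  qed
  moreover have "pdist (Z' ! j0) v' < pdist (Z ! j0) v" using Z'(2)[OF j0(1)] j0(2) by simp
  ultimately show ?thesis
    unfolding total_dist_def Z'(1) using j0(1) by (intro sum_strict_mono_ex1) auto
qed

text \<open>
  After the survivor has moved in coordinate \<open>l\<close>, the other coordinates can become unguarded only
  through a zombie that moves in them.
\<close>

lemma unguarded_reply_subset:
  assumes "v' = v(l := b)" "l \<notin> unguarded (zombie_reply v' c Z) v'"
    and "\<And>i j. i \<in> unguarded (zombie_reply v' c Z) v' \<Longrightarrow> j < length Z \<Longrightarrow> i \<noteq> c j \<or> i = l"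
  shows "unguarded (zombie_reply v' c Z) v' \<subseteq> unguarded Z v - {l}"
proof
  fix i assume i: "i \<in> unguarded (zombie_reply v' c Z) v'"
  then have "i \<noteq> l" using assms(2) by blast
  moreover have "(Z ! j) i = v i" if "j < length Z" for j
    using assms(1) assms(3)[OF i that] i that \<open>i \<noteq> l\<close> by (auto simp: unguarded_def zombie_reply_def)
  ultimately show "i \<in> unguarded Z v - {l}" using i by (auto simp: unguarded_def)
qed

text \<open>
  There remain the rounds in which the survivor moves away from all zombies, in some coordinate \<open>l\<close>.
  The zombies' moves then keep the sum of the distances, so that the two other quantities must drop.
\<close>

context
  fixes Z :: "('i \<Rightarrow> 'a) list" and v v' :: "'i \<Rightarrow> 'a" and l b
  assumes Z: "set Z \<subseteq> pverts G" and v: "v \<in> pverts G"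
    and l: "l \<in> I" "(v l, b) \<in> parcs (T l)" "v' = v(l := b)"
    and away: "\<And>j. j < length Z \<Longrightarrow> pdist (Z ! j) v' = Suc (pdist (Z ! j) v)"
begin

lemma escape_arc: "(v, v') \<in> parcs G" "v' \<in> pverts G"
  using product_arcI[OF v l(1,2)] l(3) by (auto elim: product_arcE)

lemma zombie_coord: "j < length Z \<Longrightarrow> i \<in> I \<Longrightarrow> (Z ! j) i \<in> pverts (T i)"
  using coord_in_verts Z nth_mem by blast

lemma escape_coord:
  assumes "j < length Z"
  shows "tree_dist (T l) ((Z ! j) l) b = Suc (tree_dist (T l) ((Z ! j) l) (v l))"
proof -
  have z: "Z ! j \<in> pverts G" using assms Z nth_mem by blast
  note V = zombie_coord[OF assms l(1)] coord_in_verts[OF v l(1)] coord_in_verts[OF escape_arc(2) l(1)]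
  have "pdist (v(l := b)) (Z ! j) = Suc (pdist v (Z ! j))"
    using away[OF assms] l(3) escape_arc(2) v by (simp add: pdist_commute[OF z])
  then show ?thesis
    using pdist_upd[OF l(1), of v b "Z ! j"] tree_dist_commute[OF tree[OF l(1)] V(1)] V l(3) by simp
qed

lemma can_follow: "j < length Z \<Longrightarrow> (Z ! j) l \<noteq> v' l"
  using escape_coord[of j] l(3) by auto

lemma total_dist_reply:
  assumes c: "\<And>j. j < length Z \<Longrightarrow> c j \<in> I \<and> (Z ! j) (c j) \<noteq> v' (c j)"
  shows "total_dist (zombie_reply v' c Z) v' = total_dist Z v"
  unfolding total_dist_def
  using zombie_reply_legal(3)[OF Z escape_arc(2) c] away by (intro sum.cong) auto

text \<open>
  If some zombie differs from the survivor in coordinate \<open>l\<close>, all of them follow in that coordinate.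
  This restores all differences and guards the same coordinates, but in coordinate \<open>l\<close> the room behind
  the survivor has shrunk for each zombie that differed there.
\<close>

lemma progress_when_guarded:
  assumes guarded: "l \<notin> unguarded Z v"
  shows "((v', zombie_reply v' (\<lambda>_. l) Z), (v, Z)) \<in> progress"
proof -
  let ?Z = "zombie_reply v' (\<lambda>_. l) Z"
  let ?s = "\<lambda>j. step_toward (T l) ((Z ! j) l) b"
  have eq: "?Z ! j = (Z ! j)(l := ?s j)" if "j < length Z" for j
    using that l(3) by (simp add: zombie_reply_def)
  have step: "((Z ! j) l, ?s j) \<in> parcs (T l)"
      "tree_dist (T l) ((Z ! j) l) b = Suc (tree_dist (T l) (?s j) b)" if "j < length Z" for j
    using step_toward[OF tree[OF l(1)] zombie_coord[OF that l(1)], of b] can_follow[OF that] l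
      coord_in_verts[OF escape_arc(2) l(1)] by auto
  obtain j0 where j0: "j0 < length Z" "(Z ! j0) l \<noteq> v l"
    using guarded l(1) by (auto simp: unguarded_def)
  have "?s j0 \<noteq> b"
    using escape_coord[OF j0(1)] step(2)[OF j0(1)] j0(2)
      tree_dist_eq_0_iff[OF tree[OF l(1)] zombie_coord[OF j0(1) l(1)] coord_in_verts[OF v l(1)]]
    by auto
  then have "l \<notin> unguarded ?Z v'"
    using j0(1) eq[OF j0(1)] l(3) by (auto simp: unguarded_def)
  then have "unguarded ?Z v' \<subseteq> unguarded Z v - {l}"
    by (intro unguarded_reply_subset[OF l(3)]) auto
  then have "card (unguarded ?Z v') \<le> card (unguarded Z v)"
    using finite_index by (intro card_mono) (auto simp: unguarded_def)
  moreover have "total_dist ?Z v' = total_dist Z v"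
    by (rule total_dist_reply) (use can_follow l(1) in blast)
  moreover have "room ?Z v' < room Z v"
  proof -
    let ?old = "\<lambda>j i. card (shadow (T i) ((Z ! j) i) (v i))"
    let ?new = "\<lambda>j i. card (shadow (T i) ((?Z ! j) i) (v' i))"
    have other: "?new j i = ?old j i" if "j < length Z" "i \<noteq> l" for i j
      using that l(3) eq by simp
    have less: "?new j l < ?old j l" if j: "j < length Z" "(Z ! j) l \<noteq> v l" for j
    proof -
      have "shadow (T l) (?s j) b \<subset> shadow (T l) ((Z ! j) l) (v l)"
        using shadow_shrinks[OF tree[OF l(1)] zombie_coord[OF j(1) l(1)] coord_in_verts[OF v l(1)]
            j(2) l(2) escape_coord[OF j(1)] step[OF j(1)]] .
      moreover have "finite (shadow (T l) ((Z ! j) l) (v l))"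
        using finite_tree_verts[OF tree[OF l(1)]] by (simp add: shadow_def)
      ultimately show ?thesis using eq[OF j(1)] l(3) by (simp add: psubset_card_mono)
    qed
    have same: "?new j l = ?old j l" if j: "j < length Z" "(Z ! j) l = v l" for j
    proof -
      have "tree_dist (T l) (?s j) b = 0" using escape_coord[OF j(1)] step(2)[OF j(1)] j(2) by simp
      moreover have "?s j \<in> pverts (T l)" "b \<in> pverts (T l)"
        using tree_arcs[OF tree[OF l(1)]] step(1)[OF j(1)] l(2) by auto
      ultimately have "?s j = b" using tree_dist_eq_0_iff[OF tree[OF l(1)]] by blast
      then show ?thesis using eq[OF j(1)] j(2) l(3) by simp
    qed
    have le: "?new j i \<le> ?old j i" if "j < length Z" for i j
      using other[OF that] less[OF that] same[OF that] by (cases "i = l"; cases "(Z ! j) l = v l") auto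
    have "(\<Sum>i\<in>I. ?new j i) \<le> (\<Sum>i\<in>I. ?old j i)" if "j < length Z" for j
      using le[OF that] by (intro sum_mono)
    moreover have "(\<Sum>i\<in>I. ?new j0 i) < (\<Sum>i\<in>I. ?old j0 i)"
      using le[OF j0(1)] less[OF j0] l(1) finite_index by (intro sum_strict_mono_ex1) auto
    ultimately show ?thesis
      unfolding room_def length_zombie_reply using j0(1) by (intro sum_strict_mono_ex1) auto
  qed
  ultimately show ?thesis by (auto simp: progress_def)
qed

text \<open>
  If no zombie differs from the survivor in coordinate \<open>l\<close>, the survivor's move makes all of them differ
  there.  One zombie \<open>j0\<close> leaves it at that and makes its move in a coordinate \<open>m\<close> that stays guarded
  without this step, while all others follow in coordinate \<open>l\<close>.  So coordinate \<open>l\<close> becomes guarded and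
  no guarded coordinate is lost.
\<close>

lemma progress_when_unguarded:
  assumes unguarded: "l \<in> unguarded Z v" and far: "card I \<le> total_dist Z v"
  shows "\<exists>c. (\<forall>j<length Z. c j \<in> I \<and> (Z ! j) (c j) \<noteq> v' (c j)) \<and>
    ((v', zombie_reply v' c Z), (v, Z)) \<in> progress"
proof -
  obtain m where m: "m \<in> I" "m \<noteq> l"
    and two: "2 \<le> (\<Sum>j<length Z. tree_dist (T m) ((Z ! j) m) (v m))" (is "_ \<le> sum ?d _")
    using doubly_guarded_coordinate[OF far unguarded] by blast
  have "\<exists>j<length Z. ?d j \<noteq> 0"
  proof (rule ccontr)
    assume "\<not> ?thesis"
    then have "sum ?d {..<length Z} = 0" by simp
    then show False using two by linarith
  qed
  then obtain j0 where j0: "j0 < length Z" "?d j0 \<noteq> 0" by blast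
  define c where "c j = (if j = j0 then m else l)" for j
  let ?Z = "zombie_reply v' c Z"
  have vm: "v' m = v m" using m(2) l(3) by simp
  have legal: "c j \<in> I \<and> (Z ! j) (c j) \<noteq> v' (c j)" if "j < length Z" for j
    using that can_follow[OF that] l(1) m(1) vm j0 by (auto simp: c_def)
  \<comment> \<open>\<open>j0\<close> is left behind in coordinate \<open>l\<close>\<close>
  have "(?Z ! j0) l = v l" "j0 < length Z" "v l \<noteq> v' l"
    using j0(1) unguarded m(2) tree_arcs(3)[OF tree[OF l(1)] l(2)] l(3)
    by (auto simp: zombie_reply_def c_def unguarded_def)
  then have "l \<notin> unguarded ?Z v'" by (auto simp: unguarded_def)
  moreover have "m \<notin> unguarded ?Z v'"
  proof (cases "?d j0 = 1")
    case True
    \<comment> \<open>another zombie guards \<open>m\<close>\<close>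
    have "sum ?d {..<length Z} = ?d j0 + sum ?d ({..<length Z} - {j0})"
      using j0(1) by (simp add: sum.remove)
    then have "sum ?d ({..<length Z} - {j0}) \<noteq> 0" using True two by linarith
    then obtain j1 where j1: "j1 < length Z" "j1 \<noteq> j0" "?d j1 \<noteq> 0"
      by (metis (no_types, lifting) DiffE insertI1 lessThan_iff sum.neutral)
    then have "(?Z ! j1) m = (Z ! j1) m" using m(2) by (simp add: zombie_reply_def c_def)
    moreover have "(Z ! j1) m \<noteq> v' m" using j1(3) vm by auto
    ultimately show ?thesis using j1(1) by (auto simp: unguarded_def)
  next
    case False
    \<comment> \<open>after its step, \<open>j0\<close> is still at positive distance in \<open>m\<close>\<close>
    have "(Z ! j0) m \<noteq> v m" using j0(2) by auto
    then have "?d j0 = Suc (tree_dist (T m) ((?Z ! j0) m) (v m))"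
      using step_toward(2)[OF tree[OF m(1)] zombie_coord[OF j0(1) m(1)] coord_in_verts[OF v m(1)]]
        j0(1) vm by (simp add: zombie_reply_def c_def)
    then have "(?Z ! j0) m \<noteq> v' m" using False vm by auto
    then show ?thesis using j0(1) by (auto simp: unguarded_def)
  qed
  ultimately have "unguarded ?Z v' \<subseteq> unguarded Z v - {l}"
    by (intro unguarded_reply_subset[OF l(3)]) (auto simp: c_def)
  then have "card (unguarded ?Z v') < card (unguarded Z v)"
    using finite_index unguarded by (intro psubset_card_mono) (auto simp: unguarded_def)
  moreover have "total_dist ?Z v' = total_dist Z v"
    by (rule total_dist_reply) (use legal in blast)
  ultimately have "((v', ?Z), (v, Z)) \<in> progress" by (simp add: progress_def)
  then show ?thesis using legal by blast
qed

end

lemma coordinates_to_move: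
  assumes "set Z \<subseteq> pverts G" "v \<in> pverts G" "v \<notin> set Z"
  shows "\<exists>c. \<forall>j<length Z. c j \<in> I \<and> (Z ! j) (c j) \<noteq> v (c j)"
proof -
  have "\<exists>i. i \<in> I \<and> (Z ! j) i \<noteq> v i" if "j < length Z" for j
    using verts_eqI[of "Z ! j" v] assms nth_mem[OF that] by fastforce
  then show ?thesis by metis
qed

lemma progress_round:
  assumes Z: "set Z \<subseteq> pverts G" "0 < length Z" "card I \<le> total_dist Z v"
    and v: "v \<in> pverts G" "v' = v \<or> (v, v') \<in> parcs G" "v' \<notin> set Z"
  shows "\<exists>c. (\<forall>j<length Z. c j \<in> I \<and> (Z ! j) (c j) \<noteq> v' (c j)) \<and>
    ((v', zombie_reply v' c Z), (v, Z)) \<in> progress"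
proof (cases "\<exists>j<length Z. pdist (Z ! j) v' \<le> pdist (Z ! j) v")
  case True
  have v'V: "v' \<in> pverts G" using v by (auto elim: product_arcE)
  obtain c where c: "\<forall>j<length Z. c j \<in> I \<and> (Z ! j) (c j) \<noteq> v' (c j)"
    using coordinates_to_move[OF Z(1) v'V v(3)] by blast
  obtain j0 where j0: "j0 < length Z" "pdist (Z ! j0) v' \<le> pdist (Z ! j0) v"
    using True by blast
  have "total_dist (zombie_reply v' c Z) v' < total_dist Z v"
    by (rule progress_when_closer[OF Z(1) v(1,2) length_zombie_reply
          zombie_reply_legal(3)[OF Z(1) v'V c[rule_format]] j0])
  then show ?thesis using c by (auto simp: progress_def)
next
  case False
  then have arc: "(v, v') \<in> parcs G" using v(2) Z(2) by auto
  then obtain l b where l: "l \<in> I" "(v l, b) \<in> parcs (T l)" "v' = v(l := b)"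
    by (rule product_arcE)
  have away: "pdist (Z ! j) v' = Suc (pdist (Z ! j) v)" if j: "j < length Z" for j
  proof -
    have z: "Z ! j \<in> pverts G" using j Z(1) nth_mem by blast
    have "v' \<in> pverts G" using arc by (auto elim: product_arcE)
    then show ?thesis using pdist_arc[OF arc z] False j v(1) by (auto simp: pdist_commute[OF z])
  qed
  show ?thesis
  proof (cases "l \<in> unguarded Z v")
    case True
    show ?thesis
      by (rule progress_when_unguarded[OF Z(1) v(1) l]) (fact away True Z(3))+
  next
    case False
    have "((v', zombie_reply v' (\<lambda>_. l) Z), (v, Z)) \<in> progress"
      by (rule progress_when_guarded[OF Z(1) v(1) l]) (fact away False)+
    moreover have "(Z ! j) l \<noteq> v' l" if "j < length Z" for j
      by (rule can_follow[OF Z(1) v(1) l]) (fact away that)+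
    ultimately show ?thesis using l(1) by (intro exI[of _ "\<lambda>_. l"]) simp
  qed
qed

text \<open>
  Zombies that start on the two ends of an edge, in turn, are alternating wherever the survivor
  starts, and remain so.  An alternating set of \<open>k\<close> zombies none of which has reached the survivor is at
  total distance at least \<open>k + k div 2\<close>, which is what \<open>progress_round\<close> requires.
\<close>

theorem enough_zombies_win:
  assumes I: "I \<noteq> {}" and k: "card I \<le> k + k div 2"
  shows "\<exists>\<sigma>. winning_zombie_strategy G k \<sigma>"
proof -
  obtain u where u: "u \<in> pverts G" using product_vertex by blast
  obtain i where "i \<in> I" using I by blast
  obtain e where "\<And>i. i \<in> I \<Longrightarrow> (u i, e i) \<in> parcs (T i)"
    using neighbour_function[OF u] by blast
  then obtain u' where u': "(u, u') \<in> parcs G"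
    using product_arcI[OF u \<open>i \<in> I\<close>] \<open>i \<in> I\<close> by blast
  define Z0 where "Z0 = map (\<lambda>j. if even j then u else u') [0..<k]"
  have Z0: "length Z0 = k" "set Z0 \<subseteq> pverts G"
    using u u' by (auto simp: Z0_def elim: product_arcE)
  have Z0_alternating: "alternating Z0 v" if "v \<in> pverts G" for v
    unfolding alternating_def
    using pdist_arc[OF u' that] Z0(1) by (intro exI[of _ "pdist u v"]) (auto simp: Z0_def)
  define Inv where "Inv v Z \<longleftrightarrow> length Z = k \<and> set Z \<subseteq> pverts G \<and> v \<in> pverts G \<and> v \<notin> set Z \<and>
    alternating Z v" for v Z
  have kpos: "0 < k" using I k finite_index by (cases k) auto
  have reply: "zombies_move G v' Z (zombie_reply v' c Z) \<and>
      (v' \<in> set (zombie_reply v' c Z) \<or> Inv v' (zombie_reply v' c Z))"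
    if "length Z = k" "set Z \<subseteq> pverts G" "alternating Z v" "v \<in> pverts G"
      "v' = v \<or> (v, v') \<in> parcs G" "\<forall>j<length Z. c j \<in> I \<and> (Z ! j) (c j) \<noteq> v' (c j)" for v v' Z c
  proof -
    have v': "v' \<in> pverts G" using that(4,5) by (auto elim: product_arcE)
    note legal = zombie_reply_legal[OF that(2) v' that(6)[rule_format]]
    have "alternating (zombie_reply v' c Z) v'"
      by (rule alternating_round[OF that(2,3) length_zombie_reply that(5) legal(3)])
    then show ?thesis using legal(1,2) that(1) v' by (simp add: Inv_def)
  qed
  show ?thesis
  proof (rule winning_zombie_strategyI[where Inv = Inv and R = progress, OF Z0])
    show "\<exists>Z. zombies_move G v Z0 Z \<and> (v \<in> set Z \<or> Inv v Z)" if v: "v \<in> pverts G" "v \<notin> set Z0" for v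
    proof -
      obtain c where "\<forall>j<length Z0. c j \<in> I \<and> (Z0 ! j) (c j) \<noteq> v (c j)"
        using coordinates_to_move[OF Z0(2) v] by blast
      from reply[OF Z0 Z0_alternating[OF v(1)] v(1) _ this] show ?thesis by (intro exI) simp
    qed
    show "wf progress" by (simp add: progress_def)
    show "\<exists>Z'. zombies_move G v' Z Z' \<and>
        (v' \<in> set Z' \<or> Inv v' Z' \<and> ((v', Z'), (v, Z)) \<in> progress)"
      if inv: "Inv v Z" and v': "v' = v \<or> (v, v') \<in> parcs G" "v' \<notin> set Z" for v Z v'
    proof -
      have Z: "length Z = k" "set Z \<subseteq> pverts G" "v \<in> pverts G" "v \<notin> set Z" "alternating Z v"
        using inv by (auto simp: Inv_def)
      obtain c where c: "\<And>j. j < k \<Longrightarrow> even (pdist (Z ! j) v + j + c)"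
        using Z(1,5) by (auto simp: alternating_def)
      have "0 < pdist (Z ! j) v" if "j < k" for j
        using pdist_eq_0_iff[of "Z ! j" v] Z nth_mem[of j Z] that by fastforce
      then have "card I \<le> total_dist Z v"
        using sum_alternating_ge[of k "\<lambda>j. pdist (Z ! j) v" c] c k Z(1) by (simp add: total_dist_def)
      from progress_round[OF Z(2) _ this Z(3) v'] Z(1) kpos obtain c
        where c: "\<forall>j<length Z. c j \<in> I \<and> (Z ! j) (c j) \<noteq> v' (c j)"
          "((v', zombie_reply v' c Z), (v, Z)) \<in> progress" by blast
      with reply[OF Z(1,2,5,3) v'(1) c(1)] show ?thesis
        by (intro exI[of _ "zombie_reply v' c Z"]) simp
    qed
  qed
qed

text \<open>
  The numerator \<open>2 * card I + 2\<close> makes the truncating division round up.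
\<close>

theorem zombie_number_product:
  assumes "I \<noteq> {}"
  shows "zombie_number G = (2 * card I + 2) div 3"
  unfolding zombie_number_def
proof (rule Least_equality)
  show "\<exists>\<sigma>. winning_zombie_strategy G ((2 * card I + 2) div 3) \<sigma>"
    by (rule enough_zombies_win[OF assms]) linarith
  show "(2 * card I + 2) div 3 \<le> k" if "\<exists>\<sigma>. winning_zombie_strategy G k \<sigma>" for k
  proof -
    have "\<not> 3 * k < 2 * card I" using few_zombies_lose that by blast
    then show ?thesis by presburger
  qed
qed

end

theorem theorem6:
  fixes n :: nat and T :: "nat \<Rightarrow> 'a pair_pre_digraph"
  assumes "n \<ge> 2"
    and "\<And>i. i \<in> {1..n} \<Longrightarrow> nontrivial_tree (T i)"
  shows "int (zombie_number (cartesian_product {1..n} T)) = \<lceil>2 * real n / 3\<rceil>"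
proof -
  interpret tree_product "{1..n}" T
    by unfold_locales (use assms(2) in auto)
  have "zombie_number (cartesian_product {1..n} T) = (2 * n + 2) div 3"
    using zombie_number_product assms(1) by simp
  moreover have "\<lceil>2 * real n / 3\<rceil> = int ((2 * n + 2) div 3)"
    by (rule ceiling_unique) (use div_mult_mod_eq[of "2 * n + 2" 3] in linarith)+
  ultimately show ?thesis by simp
qed

end
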